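(* Let $A, B \in \mathbb{P}$. Then for every $t \in \mathbb{R}$, $$F_{t}(A, B) \leq I \iff (A^{\frac{1}{2}} B A^{\frac{1}{2}})^{t} \leq A^{2t-1}.$$
   Context: $\mathbb{P}$ denotes the set of positive definite (i.e. positive invertible) bounded linear operators on a complex Hilbert space $\mathcal{H}$; $I$ is the identity operator and $\leq$ is the L\"owner order on bounded self-adjoint operators ($X \le Y$ iff $Y-X$ is positive semidefinite). Real powers of elements of $\mathbb{P}$ are defined by functional calculus. For $A,B\in\mathbb{P}$ and $t\in\mathbb{R}$, put $A \sharp_{t} B := A^{1/2} (A^{-1/2} B A^{-1/2})^{t} A^{1/2}$ and $F_{t}(A, B) := (A^{-1} \sharp_{t} B)^{1/2} A^{2-2t} (A^{-1} \sharp_{t} B)^{1/2}$. *)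

theory Defs
  imports "HOL-Analysis.Analysis" "HOL-Computational_Algebra.Polynomial"
begin

text \<open>Complex Hilbert spaces, as Banach spaces whose norm comes from a complex inner product
  (linear in the first argument). The axiom \<open>cinner_self\<close> ties it to the library norm,
  so positivity and definiteness of the inner product are those of the norm.\<close>

class complex_hilbert_space = banach +
  fixes scaleC :: "complex \<Rightarrow> 'a \<Rightarrow> 'a" (infixr "*\<^sub>C" 75)
    and cinner :: "'a \<Rightarrow> 'a \<Rightarrow> complex"
  assumes scaleC_add_right: "c *\<^sub>C (x + y) = c *\<^sub>C x + c *\<^sub>C y"
    and scaleC_add_left: "(c + d) *\<^sub>C x = c *\<^sub>C x + d *\<^sub>C x"
    and scaleC_scaleC: "c *\<^sub>C d *\<^sub>C x = (c * d) *\<^sub>C x"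
    and scaleC_of_real: "complex_of_real r *\<^sub>C x = r *\<^sub>R x"
    and cinner_commute: "cinner x y = cnj (cinner y x)"
    and cinner_add_left: "cinner (x + y) z = cinner x z + cinner y z"
    and cinner_scaleC_left: "cinner (c *\<^sub>C x) y = c * cinner x y"
    and cinner_self: "cinner x x = complex_of_real ((norm x)\<^sup>2)"

instantiation complex :: complex_hilbert_space
begin

definition scaleC_complex :: "complex \<Rightarrow> complex \<Rightarrow> complex"
  where "scaleC_complex c x = c * x"

definition cinner_complex :: "complex \<Rightarrow> complex \<Rightarrow> complex"
  where "cinner_complex x y = x * cnj y"

instance
  by standard
    (auto simp: scaleC_complex_def cinner_complex_def algebra_simps scaleR_conv_of_real
      complex_norm_square simp flip: of_real_power)

end

text \<open>The library type of bounded operators only provides real linearity, so complex linearity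
  is imposed by a predicate.\<close>

definition complex_linear :: "('a::complex_hilbert_space \<Rightarrow>\<^sub>L 'a) \<Rightarrow> bool"
  where "complex_linear T \<longleftrightarrow> (\<forall>c x. T (c *\<^sub>C x) = c *\<^sub>C T x)"

definition selfadjoint_op :: "('a::complex_hilbert_space \<Rightarrow>\<^sub>L 'a) \<Rightarrow> bool"
  where "selfadjoint_op T \<longleftrightarrow>
    complex_linear T \<and> (\<forall>x y. cinner (T x) y = cinner x (T y))"

definition positive_op :: "('a::complex_hilbert_space \<Rightarrow>\<^sub>L 'a) \<Rightarrow> bool"
  where "positive_op T \<longleftrightarrow> selfadjoint_op T \<and> (\<forall>x. 0 \<le> Re (cinner (T x) x))"

definition invertible_op :: "('a::complex_hilbert_space \<Rightarrow>\<^sub>L 'a) \<Rightarrow> bool"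
  where "invertible_op T \<longleftrightarrow>
    (\<exists>S. complex_linear S \<and> S o\<^sub>L T = id_blinfun \<and> T o\<^sub>L S = id_blinfun)"

definition posdef_op :: "('a::complex_hilbert_space \<Rightarrow>\<^sub>L 'a) \<Rightarrow> bool"
  where "posdef_op T \<longleftrightarrow> positive_op T \<and> invertible_op T"

definition loewner_le ::
    "('a::complex_hilbert_space \<Rightarrow>\<^sub>L 'a) \<Rightarrow> ('a \<Rightarrow>\<^sub>L 'a) \<Rightarrow> bool" (infix "\<le>\<^sub>L" 50)
  where "X \<le>\<^sub>L Y \<longleftrightarrow> selfadjoint_op X \<and> selfadjoint_op Y \<and> positive_op (Y - X)"

lemma bounded_linear_scaleC: "bounded_linear (\<lambda>x::'a::complex_hilbert_space. c *\<^sub>C x)"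
proof (rule bounded_linear_intro[where K = "norm c"])
  fix x y :: 'a and r :: real
  show "c *\<^sub>C (x + y) = c *\<^sub>C x + c *\<^sub>C y" by (rule scaleC_add_right)
  show "c *\<^sub>C (r *\<^sub>R x) = r *\<^sub>R (c *\<^sub>C x)"
    by (simp add: scaleC_scaleC mult.commute flip: scaleC_of_real)
  have "complex_of_real ((norm (c *\<^sub>C x))\<^sup>2) = c * cnj c * cinner x x"
    by (metis cinner_commute cinner_scaleC_left cinner_self complex_cnj_mult mult.assoc)
  also have "\<dots> = complex_of_real ((norm x * norm c)\<^sup>2)"
    by (simp add: cinner_self complex_norm_square[symmetric] power_mult_distrib)
  finally show "norm (c *\<^sub>C x) \<le> norm x * norm c"
    by (metis of_real_eq_iff norm_ge_zero mult_nonneg_nonneg order_refl power2_eq_imp_eq)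
qed

text \<open>\<open>scalar_op z\<close> is \<open>z I\<close>; by \<open>bounded_linear_scaleC\<close>, \<open>Blinfun\<close> is applied within its domain.\<close>

definition scalar_op :: "complex \<Rightarrow> ('a::complex_hilbert_space \<Rightarrow>\<^sub>L 'a)"
  where "scalar_op z = Blinfun (\<lambda>x. z *\<^sub>C x)"

definition op_spectrum :: "('a::complex_hilbert_space \<Rightarrow>\<^sub>L 'a) \<Rightarrow> complex set"
  where "op_spectrum T = {z. \<not> invertible_op (T - scalar_op z)}"

definition poly_op :: "real poly \<Rightarrow> ('a::complex_hilbert_space \<Rightarrow>\<^sub>L 'a) \<Rightarrow> ('a \<Rightarrow>\<^sub>L 'a)"
  where "poly_op p T = (\<Sum>i\<le>degree p. coeff p i *\<^sub>R ((\<lambda>S. T o\<^sub>L S) ^^ i) id_blinfun)"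

text \<open>Continuous functional calculus of a self-adjoint operator \<open>T\<close> (whose spectrum is a compact set
  of reals) for a real function \<open>f\<close> continuous on the spectrum: \<open>f(T)\<close> is the operator-norm limit of
  \<open>p\<^sub>n(T)\<close> for polynomials \<open>p\<^sub>n\<close> tending to \<open>f\<close> uniformly on the spectrum.\<close>

definition cfc :: "(real \<Rightarrow> real) \<Rightarrow> ('a::complex_hilbert_space \<Rightarrow>\<^sub>L 'a) \<Rightarrow> ('a \<Rightarrow>\<^sub>L 'a)"
  where "cfc f T = (THE S. \<exists>p :: nat \<Rightarrow> real poly.
    uniform_limit {x. complex_of_real x \<in> op_spectrum T} (\<lambda>n. poly (p n)) f sequentially \<and>
    (\<lambda>n. poly_op (p n) T) \<longlonglongrightarrow> S)"

definition op_powr :: "('a::complex_hilbert_space \<Rightarrow>\<^sub>L 'a) \<Rightarrow> real \<Rightarrow> ('a \<Rightarrow>\<^sub>L 'a)"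
    (infixr "powr\<^sub>L" 80)
  where "T powr\<^sub>L t = cfc (\<lambda>x. x powr t) T"

definition geom_mean ::
    "real \<Rightarrow> ('a::complex_hilbert_space \<Rightarrow>\<^sub>L 'a) \<Rightarrow> ('a \<Rightarrow>\<^sub>L 'a) \<Rightarrow> ('a \<Rightarrow>\<^sub>L 'a)"
  where "geom_mean t A B =
    A powr\<^sub>L (1/2) o\<^sub>L
    ((A powr\<^sub>L (-1/2) o\<^sub>L B o\<^sub>L A powr\<^sub>L (-1/2)) powr\<^sub>L t) o\<^sub>L
    A powr\<^sub>L (1/2)"

definition F_mean ::
    "real \<Rightarrow> ('a::complex_hilbert_space \<Rightarrow>\<^sub>L 'a) \<Rightarrow> ('a \<Rightarrow>\<^sub>L 'a) \<Rightarrow> ('a \<Rightarrow>\<^sub>L 'a)"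
  where "F_mean t A B =
    geom_mean t (A powr\<^sub>L (-1)) B powr\<^sub>L (1/2) o\<^sub>L
    A powr\<^sub>L (2 - 2 * t) o\<^sub>L
    geom_mean t (A powr\<^sub>L (-1)) B powr\<^sub>L (1/2)"

end

theory Submission
  imports Defs "HOL-Computational_Algebra.Fundamental_Theorem_Algebra"
begin

text \<open>
  Write \<open>K = (A^(1/2) B A^(1/2))^t\<close>. Since \<open>A^(-1)\<close> has the powers \<open>(A^(-1))^(1/2) = A^(-1/2)\<close> and
  \<open>(A^(-1))^(-1/2) = A^(1/2)\<close>, the geometric mean of \<open>A^(-1)\<close> and \<open>B\<close> is
  \<open>G = A^(-1/2) K A^(-1/2)\<close>, and the operator to be compared with \<open>I\<close> is \<open>X X\<^sup>*\<close> for
  \<open>X = G^(1/2) A^(1-t)\<close>. Now \<open>X X\<^sup>* \<le> I\<close> says that \<open>X\<^sup>*\<close> is a contraction, hence that \<open>X\<close> is one, hence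
  that \<open>X\<^sup>* X \<le> I\<close> (\<open>contraction_adjoint\<close>). But
  \<open>X\<^sup>* X = A^(1-t) G A^(1-t) = A^(1/2-t) K A^(1/2-t)\<close>, and multiplying by \<open>A^(t-1/2)\<close> on both sides
  turns \<open>X\<^sup>* X \<le> I\<close> into \<open>K \<le> A^(2t-1)\<close> (\<open>sandwich_le_id_iff\<close>). Every step is reversible.

  The bulk of the work is to justify the calculation with real powers, that is, to
  establish the continuous functional calculus. Its heart is the bound
  \<open>\<parallel>p(T)\<parallel> \<le> sup {\<bar>p(x)\<bar> | x in the spectrum of T}\<close> for self-adjoint \<open>T\<close> and real
  polynomials \<open>p\<close> (\<open>norm_poly_op_le\<close>). It combines two facts: one of \<open>\<plusminus>\<parallel>S\<parallel>\<close> lies in the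
  spectrum of a self-adjoint \<open>S\<close> on a nonzero space (\<open>norm_in_real_spectrum\<close>), and a nonzero polynomial without zeros on
  the spectrum of \<open>T\<close> takes \<open>T\<close> to an invertible operator (\<open>invertible_poly_op\<close>). The bound makes
  limits of polynomials in \<open>T\<close> exist and depend only on the limit function on the spectrum;
  multiplicativity, self-adjointness and commutation pass to the limit.
  The one law of powers that does not follow from multiplicativity on a single spectrum,
  the composition law \<open>(A^(-1))^(1/2) = A^(-1/2)\<close>, comes from uniqueness of
  positive definite square roots (\<open>op_powr_half_eqI\<close>).
\<close>

section \<open>The real inner product\<close>

text \<open>The real part alone suffices for the arguments below: it determines the norm, and together with
  complex linearity it detects self-adjointness, while being a symmetric real bilinear form.\<close>

definition rinner :: "'a::complex_hilbert_space \<Rightarrow> 'a \<Rightarrow> real"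
  where "rinner x y = Re (cinner x y)"

lemma rinner_commute: "rinner x y = rinner y x"
  unfolding rinner_def by (subst cinner_commute) simp

lemma rinner_add_left: "rinner (x + y) z = rinner x z + rinner y z"
  by (simp add: rinner_def cinner_add_left)

lemma rinner_add_right: "rinner z (x + y) = rinner z x + rinner z y"
  by (metis rinner_add_left rinner_commute)

lemma rinner_scaleR_left: "rinner (r *\<^sub>R x) y = r * rinner x y"
  by (simp add: rinner_def cinner_scaleC_left flip: scaleC_of_real)

lemma rinner_scaleR_right: "rinner y (r *\<^sub>R x) = r * rinner y x"
  by (metis rinner_scaleR_left rinner_commute)

lemma rinner_minus_left: "rinner (- x) y = - rinner x y"
  using rinner_scaleR_left[of "-1" x y] by simp

lemma rinner_minus_right: "rinner y (- x) = - rinner y x"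
  by (metis rinner_minus_left rinner_commute)

lemma rinner_diff_left: "rinner (x - y) z = rinner x z - rinner y z"
  using rinner_add_left[of x "- y" z] by (simp add: rinner_minus_left)

lemma rinner_diff_right: "rinner z (x - y) = rinner z x - rinner z y"
  by (metis rinner_diff_left rinner_commute)

lemmas rinner_linear =
  rinner_add_left rinner_add_right rinner_diff_left rinner_diff_right
  rinner_scaleR_left rinner_scaleR_right rinner_minus_left rinner_minus_right

lemma rinner_self: "rinner x x = (norm x)\<^sup>2"
  by (simp add: rinner_def cinner_self)

lemma rinner_polarization: "rinner x y = ((norm (x + y))\<^sup>2 - (norm x)\<^sup>2 - (norm y)\<^sup>2) / 2"
  by (simp add: rinner_linear rinner_commute[of y x] flip: rinner_self)

lemma norm_diff_power2: "(norm (x - y))\<^sup>2 = (norm x)\<^sup>2 - 2 * rinner x y + (norm y)\<^sup>2"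
  by (simp add: rinner_linear rinner_commute[of y x] flip: rinner_self)

lemma tendsto_rinner:
  assumes "(f \<longlongrightarrow> x) F" and "(g \<longlongrightarrow> y) F"
  shows "((\<lambda>n. rinner (f n) (g n)) \<longlongrightarrow> rinner x y) F"
  unfolding rinner_polarization by (intro tendsto_intros assms) simp_all

text \<open>Semidefiniteness suffices, so that the inequality also applies to
  \<open>\<lambda>x y. rinner (T x) y\<close> for positive \<open>T\<close>. The quadratic polynomial
  \<open>s \<mapsto> b (x + s y) (x + s y)\<close> is nonnegative; evaluate it at its minimum, or far out if it is
  affine.\<close>

lemma semidefinite_form_Cauchy_Schwarz:
  fixes b :: "'b::real_vector \<Rightarrow> 'b \<Rightarrow> real"
  assumes add: "\<And>x y z. b (x + y) z = b x z + b y z"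
    and scale: "\<And>r x y. b (r *\<^sub>R x) y = r * b x y"
    and sym: "\<And>x y. b x y = b y x"
    and nonneg: "\<And>x. 0 \<le> b x x"
  shows "(b x y)\<^sup>2 \<le> b x x * b y y"
proof -
  have quad: "0 \<le> b x x + 2 * s * b x y + s\<^sup>2 * b y y" for s
  proof -
    have "b (x + s *\<^sub>R y) (x + s *\<^sub>R y) = b x x + 2 * s * b x y + s\<^sup>2 * b y y"
      using sym[of x "x + s *\<^sub>R y"] sym[of y "x + s *\<^sub>R y"] sym[of y x]
      by (simp add: add scale algebra_simps power2_eq_square)
    then show ?thesis using nonneg[of "x + s *\<^sub>R y"] by simp
  qed
  show ?thesis
  proof (cases "b y y = 0")
    case True
    have "b x y = 0"
    proof (rule ccontr)
      assume nz: "b x y \<noteq> 0"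
      have "2 * (- (b x x + 1) / (2 * b x y)) * b x y = - (b x x + 1)" using nz by simp
      then show False using quad[of "- (b x x + 1) / (2 * b x y)"] True by simp
    qed
    then show ?thesis using True by simp
  next
    case False
    then have pos: "0 < b y y" using nonneg[of y] by simp
    have "0 \<le> b x x - (b x y)\<^sup>2 / b y y"
      using quad[of "- b x y / b y y"] pos by (simp add: field_simps power2_eq_square)
    then show ?thesis using pos by (simp add: field_simps)
  qed
qed

lemma rinner_le_norm: "rinner x y \<le> norm x * norm y"
proof -
  have "(rinner x y)\<^sup>2 \<le> rinner x x * rinner y y"
    by (rule semidefinite_form_Cauchy_Schwarz)
      (simp_all add: rinner_linear rinner_commute rinner_self)
  then have "(rinner x y)\<^sup>2 \<le> (norm x * norm y)\<^sup>2"
    by (simp add: rinner_self power_mult_distrib)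
  then show ?thesis by (rule power2_le_imp_le) simp
qed

section \<open>Complex linear and self-adjoint operators\<close>

lemma blinfun_compose_assoc: "(R o\<^sub>L S) o\<^sub>L T = R o\<^sub>L (S o\<^sub>L T)"
  by (rule blinfun_eqI) simp

lemma blinfun_compose_id [simp]: "id_blinfun o\<^sub>L T = T" "T o\<^sub>L id_blinfun = T"
  by (simp_all add: blinfun_eqI)

lemmas blinfun_compose_linear =
  bounded_bilinear.add_left[OF bounded_bilinear_blinfun_compose]
  bounded_bilinear.add_right[OF bounded_bilinear_blinfun_compose]
  bounded_bilinear.diff_left[OF bounded_bilinear_blinfun_compose]
  bounded_bilinear.diff_right[OF bounded_bilinear_blinfun_compose]
  bounded_bilinear.scaleR_left[OF bounded_bilinear_blinfun_compose]
  bounded_bilinear.scaleR_right[OF bounded_bilinear_blinfun_compose]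

lemma complex_linear_id: "complex_linear id_blinfun"
  by (simp add: complex_linear_def)

lemma complex_linear_compose:
  "complex_linear S \<Longrightarrow> complex_linear T \<Longrightarrow> complex_linear (S o\<^sub>L T)"
  by (simp add: complex_linear_def)

lemma complex_linear_add:
  "complex_linear S \<Longrightarrow> complex_linear T \<Longrightarrow> complex_linear (S + T)"
  by (simp add: complex_linear_def blinfun.add_left scaleC_add_right)

lemma complex_linear_scaleR:
  "complex_linear T \<Longrightarrow> complex_linear (r *\<^sub>R T)"
  by (simp add: complex_linear_def blinfun.scaleR_left scaleC_scaleC mult.commute
      flip: scaleC_of_real)

text \<open>The imaginary part of \<open>\<langle>T x, y\<rangle>\<close> is the real part of
  \<open>\<langle>T (-\<i> x), y\<rangle>\<close>, so symmetry of the real parts gives symmetry of the complex inner product.\<close>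

lemma selfadjoint_op_iff_rinner:
  "selfadjoint_op T \<longleftrightarrow> complex_linear T \<and> (\<forall>x y. rinner (T x) y = rinner x (T y))"
proof safe
  assume lin: "complex_linear T" and sym: "\<forall>x y. rinner (T x) y = rinner x (T y)"
  have "cinner (T x) y = cinner x (T y)" for x y
  proof (rule complex_eqI)
    show "Re (cinner (T x) y) = Re (cinner x (T y))"
      using sym by (simp add: rinner_def)
    have "rinner (T ((- \<i>) *\<^sub>C x)) y = rinner ((- \<i>) *\<^sub>C x) (T y)"
      using sym by simp
    then have "rinner ((- \<i>) *\<^sub>C T x) y = rinner ((- \<i>) *\<^sub>C x) (T y)"
      using lin by (simp only: complex_linear_def)
    then show "Im (cinner (T x) y) = Im (cinner x (T y))"
      by (simp add: rinner_def cinner_scaleC_left)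
  qed
  then show "selfadjoint_op T" using lin by (simp add: selfadjoint_op_def)
qed (simp_all add: selfadjoint_op_def rinner_def)

lemma selfadjoint_op_rinner: "selfadjoint_op T \<Longrightarrow> rinner (T x) y = rinner x (T y)"
  by (simp add: selfadjoint_op_iff_rinner)

lemma selfadjoint_op_linear: "selfadjoint_op T \<Longrightarrow> complex_linear T"
  by (simp add: selfadjoint_op_def)

lemma selfadjoint_op_id: "selfadjoint_op id_blinfun"
  by (simp add: selfadjoint_op_def complex_linear_id)

lemma selfadjoint_op_add: "selfadjoint_op S \<Longrightarrow> selfadjoint_op T \<Longrightarrow> selfadjoint_op (S + T)"
  by (simp add: selfadjoint_op_iff_rinner complex_linear_add blinfun.add_left rinner_linear)

lemma selfadjoint_op_scaleR: "selfadjoint_op T \<Longrightarrow> selfadjoint_op (r *\<^sub>R T)"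
  by (simp add: selfadjoint_op_iff_rinner complex_linear_scaleR blinfun.scaleR_left rinner_linear)

lemma selfadjoint_op_diff: "selfadjoint_op S \<Longrightarrow> selfadjoint_op T \<Longrightarrow> selfadjoint_op (S - T)"
  using selfadjoint_op_add[of S "(-1) *\<^sub>R T"] selfadjoint_op_scaleR[of T "-1"] by simp

lemma selfadjoint_op_compose:
  assumes "selfadjoint_op S" and "selfadjoint_op T" and "S o\<^sub>L T = T o\<^sub>L S"
  shows "selfadjoint_op (S o\<^sub>L T)"
proof -
  have "rinner (S (T x)) y = rinner x (S (T y))" for x y
    using assms by (metis blinfun_apply_blinfun_compose selfadjoint_op_rinner)
  then show ?thesis
    using assms by (simp add: selfadjoint_op_iff_rinner complex_linear_compose)
qed

lemma selfadjoint_op_conj: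
  assumes "selfadjoint_op S" and "selfadjoint_op T"
  shows "selfadjoint_op (S o\<^sub>L T o\<^sub>L S)"
  using assms by (simp add: selfadjoint_op_iff_rinner complex_linear_compose)

lemma selfadjoint_op_limit:
  assumes lim: "X \<longlonglongrightarrow> T" and sa: "\<And>n. selfadjoint_op (X n)"
  shows "selfadjoint_op T"
proof -
  have app: "(\<lambda>n. X n x) \<longlonglongrightarrow> T x" for x
    by (intro tendsto_intros lim)
  have "T (c *\<^sub>C x) = c *\<^sub>C T x" for c x
  proof (rule LIMSEQ_unique[OF app])
    have "(\<lambda>n. c *\<^sub>C X n x) \<longlonglongrightarrow> c *\<^sub>C T x"
      by (rule bounded_linear.tendsto[OF bounded_linear_scaleC app])
    then show "(\<lambda>n. X n (c *\<^sub>C x)) \<longlonglongrightarrow> c *\<^sub>C T x"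
      using sa by (simp add: selfadjoint_op_def complex_linear_def)
  qed
  moreover have "rinner (T x) y = rinner x (T y)" for x y
  proof (rule LIMSEQ_unique)
    show "(\<lambda>n. rinner (X n x) y) \<longlonglongrightarrow> rinner (T x) y"
      by (intro tendsto_rinner app tendsto_const)
    show "(\<lambda>n. rinner (X n x) y) \<longlonglongrightarrow> rinner x (T y)"
      unfolding selfadjoint_op_rinner[OF sa] by (intro tendsto_rinner app tendsto_const)
  qed
  ultimately show ?thesis by (simp add: selfadjoint_op_iff_rinner complex_linear_def)
qed

lemma positive_op_iff_rinner:
  "positive_op T \<longleftrightarrow> selfadjoint_op T \<and> (\<forall>x. 0 \<le> rinner (T x) x)"
  by (simp add: positive_op_def rinner_def)

lemma loewner_le_iff_rinner:
  "X \<le>\<^sub>L Y \<longleftrightarrow>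
    selfadjoint_op X \<and> selfadjoint_op Y \<and> (\<forall>x. rinner (X x) x \<le> rinner (Y x) x)"
  by (auto simp: loewner_le_def positive_op_iff_rinner selfadjoint_op_diff blinfun.diff_left
      rinner_linear)

lemma loewner_le_conj:
  assumes "selfadjoint_op S" and "X \<le>\<^sub>L Y"
  shows "S o\<^sub>L X o\<^sub>L S \<le>\<^sub>L S o\<^sub>L Y o\<^sub>L S"
  using assms
  by (simp add: loewner_le_iff_rinner selfadjoint_op_conj selfadjoint_op_rinner[of S])

text \<open>With \<open>X = P Q\<close> and \<open>X\<^sup>* = Q P\<close>: an operator and its adjoint have the same norm, because
  \<open>\<parallel>X x\<parallel>\<^sup>2 = \<langle>X\<^sup>* (X x), x\<rangle> \<le> \<parallel>X x\<parallel> \<parallel>x\<parallel>\<close> whenever \<open>X\<^sup>*\<close> is a contraction.\<close>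

lemma contraction_adjoint:
  assumes P: "selfadjoint_op P" and Q: "selfadjoint_op Q"
    and le: "P o\<^sub>L (Q o\<^sub>L Q) o\<^sub>L P \<le>\<^sub>L id_blinfun"
  shows "Q o\<^sub>L (P o\<^sub>L P) o\<^sub>L Q \<le>\<^sub>L id_blinfun"
proof -
  have contr: "norm (Q (P x)) \<le> norm x" for x
  proof (rule power2_le_imp_le)
    have "rinner (P (Q (Q (P x)))) x \<le> rinner x x"
      using le by (simp add: loewner_le_iff_rinner)
    then show "(norm (Q (P x)))\<^sup>2 \<le> (norm x)\<^sup>2"
      by (simp add: selfadjoint_op_rinner[OF P] selfadjoint_op_rinner[OF Q] flip: rinner_self)
  qed simp
  have contr': "norm (P (Q x)) \<le> norm x" for x
  proof -
    have "(norm (P (Q x)))\<^sup>2 = rinner (Q (P (P (Q x)))) x"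
      by (simp add: selfadjoint_op_rinner[OF P] selfadjoint_op_rinner[OF Q] flip: rinner_self)
    also have "\<dots> \<le> norm (Q (P (P (Q x)))) * norm x" by (rule rinner_le_norm)
    also have "\<dots> \<le> norm (P (Q x)) * norm x" by (intro mult_right_mono contr) simp
    finally show ?thesis
      by (cases "norm (P (Q x)) = 0") (simp_all add: power2_eq_square)
  qed
  have "rinner (Q (P (P (Q x)))) x \<le> rinner x x" for x
  proof -
    have "rinner (Q (P (P (Q x)))) x = (norm (P (Q x)))\<^sup>2"
      by (simp add: selfadjoint_op_rinner[OF P] selfadjoint_op_rinner[OF Q] flip: rinner_self)
    also have "\<dots> \<le> (norm x)\<^sup>2" by (intro power_mono contr') simp
    finally show ?thesis by (simp add: rinner_self)
  qed
  moreover have "selfadjoint_op (Q o\<^sub>L (P o\<^sub>L P) o\<^sub>L Q)"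
    by (intro selfadjoint_op_conj selfadjoint_op_compose P Q) simp
  ultimately show ?thesis by (simp add: loewner_le_iff_rinner selfadjoint_op_id)
qed

section \<open>Invertibility\<close>

text \<open>The inverse of a complex linear operator is complex linear, so a real linear bounded
  inverse is enough.\<close>

lemma invertible_opI:
  assumes lin: "complex_linear T" and ST: "S o\<^sub>L T = id_blinfun" and TS: "T o\<^sub>L S = id_blinfun"
  shows "invertible_op T"
proof -
  have ST': "S (T x) = x" and TS': "T (S x) = x" for x
    using ST TS by (metis blinfun_apply_blinfun_compose blinfun_apply_id_blinfun id_apply)+
  have "S (c *\<^sub>C x) = c *\<^sub>C S x" for c x
    using lin by (metis ST' TS' complex_linear_def)
  then show ?thesis using ST TS by (auto simp: invertible_op_def complex_linear_def)
qed

lemma invertible_op_compose: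
  assumes "invertible_op S" and "invertible_op T"
  shows "invertible_op (S o\<^sub>L T)"
proof -
  obtain U V where U: "complex_linear U" "U o\<^sub>L S = id_blinfun" "S o\<^sub>L U = id_blinfun"
    and V: "complex_linear V" "V o\<^sub>L T = id_blinfun" "T o\<^sub>L V = id_blinfun"
    using assms by (auto simp: invertible_op_def)
  have "(V o\<^sub>L U) o\<^sub>L (S o\<^sub>L T) = V o\<^sub>L (U o\<^sub>L S) o\<^sub>L T"
    "(S o\<^sub>L T) o\<^sub>L (V o\<^sub>L U) = S o\<^sub>L (T o\<^sub>L V) o\<^sub>L U"
    by (simp_all add: blinfun_compose_assoc)
  then have "(V o\<^sub>L U) o\<^sub>L (S o\<^sub>L T) = id_blinfun" "(S o\<^sub>L T) o\<^sub>L (V o\<^sub>L U) = id_blinfun"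
    using U V by simp_all
  moreover have "complex_linear (V o\<^sub>L U)" using U V by (simp add: complex_linear_compose)
  ultimately show ?thesis unfolding invertible_op_def by blast
qed

lemma invertible_op_scaleR:
  assumes "invertible_op T" and "r \<noteq> 0"
  shows "invertible_op (r *\<^sub>R T)"
proof -
  obtain S where S: "complex_linear S" "S o\<^sub>L T = id_blinfun" "T o\<^sub>L S = id_blinfun"
    using assms by (auto simp: invertible_op_def)
  then have "((1 / r) *\<^sub>R S) o\<^sub>L (r *\<^sub>R T) = id_blinfun" "(r *\<^sub>R T) o\<^sub>L ((1 / r) *\<^sub>R S) = id_blinfun"
    using assms(2) by (simp_all add: blinfun_compose_linear)
  moreover have "complex_linear ((1 / r) *\<^sub>R S)" using S(1) by (rule complex_linear_scaleR)
  ultimately show ?thesis unfolding invertible_op_def by blast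
qed

lemma invertible_op_bounded_below:
  assumes "invertible_op T"
  obtains k where "0 < k" and "\<And>x. norm x \<le> k * norm (T x)"
proof -
  obtain S where S: "S o\<^sub>L T = id_blinfun" using assms by (auto simp: invertible_op_def)
  show ?thesis
  proof
    show "0 < norm S + 1" by (simp add: add_nonneg_pos)
    fix x
    have "x = S (T x)" using S by (metis blinfun_apply_blinfun_compose blinfun_apply_id_blinfun id_apply)
    then have "norm x \<le> norm S * norm (T x)" by (metis norm_blinfun)
    also have "\<dots> \<le> (norm S + 1) * norm (T x)" by (simp add: distrib_right)
    finally show "norm x \<le> (norm S + 1) * norm (T x)" .
  qed
qed

text \<open>The Lax--Milgram lemma. To solve \<open>T x = y\<close>, observe that \<open>x \<mapsto> x - \<alpha> T x + \<alpha> y\<close> is a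
  contraction for \<open>\<alpha> = c / M\<^sup>2\<close> with \<open>M \<ge> \<parallel>T\<parallel>\<close>, since
  \<open>\<parallel>x - \<alpha> T x\<parallel>\<^sup>2 \<le> (1 - 2 \<alpha> c + \<alpha>\<^sup>2 M\<^sup>2) \<parallel>x\<parallel>\<^sup>2\<close> and this \<open>\<alpha>\<close> minimises the right-hand side.
  Coercivity also gives injectivity and a bound on the inverse.\<close>

lemma invertible_op_coercive:
  assumes lin: "complex_linear T" and c: "0 < c"
    and coer: "\<And>x. c * (norm x)\<^sup>2 \<le> rinner (T x) x"
  shows "invertible_op T"
proof -
  have below: "c * norm x \<le> norm (T x)" for x
  proof (cases "x = 0")
    case False
    have "c * (norm x)\<^sup>2 \<le> norm (T x) * norm x" using coer rinner_le_norm by (rule order_trans)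
    then have "(c * norm x) * norm x \<le> norm (T x) * norm x"
      by (simp add: power2_eq_square mult.assoc)
    then show ?thesis using False by simp
  qed simp
  have surj: "\<exists>x. T x = y" for y
  proof -
    \<comment> \<open>Adding \<open>c\<close> makes \<open>M\<close> positive and at least \<open>c\<close>, so that \<open>1 - c\<^sup>2 / M\<^sup>2\<close> is nonnegative.\<close>
    define M where "M = norm T + c"
    define \<alpha> where "\<alpha> = c / M\<^sup>2"
    define q where "q = sqrt (1 - c\<^sup>2 / M\<^sup>2)"
    have M: "0 < M" "c \<le> M" "norm T \<le> M" using c by (simp_all add: M_def add_nonneg_pos)
    have q2: "0 \<le> 1 - c\<^sup>2 / M\<^sup>2"
      using M c by (simp add: power_mono)
    have q: "0 \<le> q" "q < 1" using q2 M c by (simp_all add: q_def)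
    have contr: "norm (x - \<alpha> *\<^sub>R T x) \<le> q * norm x" for x
    proof (rule power2_le_imp_le)
      have "(norm (T x))\<^sup>2 \<le> (M * norm x)\<^sup>2"
        by (intro power_mono order_trans[OF norm_blinfun] mult_right_mono M) simp_all
      moreover have "(norm (x - \<alpha> *\<^sub>R T x))\<^sup>2
          = (norm x)\<^sup>2 - 2 * \<alpha> * rinner (T x) x + \<alpha>\<^sup>2 * (norm (T x))\<^sup>2"
        by (simp add: norm_diff_power2 rinner_scaleR_right power_mult_distrib
            rinner_commute[of x "T x"])
      moreover have "\<alpha> * (c * (norm x)\<^sup>2) \<le> \<alpha> * rinner (T x) x"
        using c M by (intro mult_left_mono coer) (simp add: \<alpha>_def)
      ultimately have "(norm (x - \<alpha> *\<^sub>R T x))\<^sup>2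
          \<le> (norm x)\<^sup>2 - 2 * (\<alpha> * (c * (norm x)\<^sup>2)) + \<alpha>\<^sup>2 * (M * norm x)\<^sup>2"
        using mult_left_mono[of "(norm (T x))\<^sup>2" "(M * norm x)\<^sup>2" "\<alpha>\<^sup>2"] by simp
      also have "\<dots> = (1 - c\<^sup>2 / M\<^sup>2) * (norm x)\<^sup>2"
        using M by (simp add: \<alpha>_def field_simps power2_eq_square)
      also have "\<dots> = (q * norm x)\<^sup>2" using q2 by (simp add: q_def power_mult_distrib)
      finally show "(norm (x - \<alpha> *\<^sub>R T x))\<^sup>2 \<le> (q * norm x)\<^sup>2" .
    qed (use q in simp)
    have "dist (u - \<alpha> *\<^sub>R T u + \<alpha> *\<^sub>R y) (v - \<alpha> *\<^sub>R T v + \<alpha> *\<^sub>R y) \<le> q * dist u v" for u v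
    proof -
      have "dist (u - \<alpha> *\<^sub>R T u + \<alpha> *\<^sub>R y) (v - \<alpha> *\<^sub>R T v + \<alpha> *\<^sub>R y)
          = norm ((u - v) - \<alpha> *\<^sub>R T (u - v))"
        by (simp add: dist_norm blinfun.diff_right scaleR_diff_right algebra_simps)
      then show ?thesis using contr[of "u - v"] by (simp add: dist_norm)
    qed
    then have "\<exists>!x. x - \<alpha> *\<^sub>R T x + \<alpha> *\<^sub>R y = x"
      using q by (intro banach_fix_type) auto
    then obtain x where "x - \<alpha> *\<^sub>R T x + \<alpha> *\<^sub>R y = x" by blast
    then have "\<alpha> *\<^sub>R (y - T x) = 0" by (simp add: algebra_simps)
    then show ?thesis using c M by (auto simp: \<alpha>_def)
  qed
  have inj: "x = y" if "T x = T y" for x y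
    using below[of "x - y"] that c by (simp add: blinfun.diff_right mult_le_0_iff)
  define g where "g y = (THE x. T x = y)" for y
  have Tg: "T (g y) = y" for y
    unfolding g_def
  proof (rule theI')
    show "\<exists>!x. T x = y" using surj[of y] inj by auto
  qed
  have gT: "g (T x) = x" for x
    using inj Tg by blast
  have "bounded_linear g"
  proof (rule bounded_linear_intro)
    show "g (x + y) = g x + g y" for x y by (rule inj) (simp add: Tg blinfun.add_right)
    show "g (r *\<^sub>R x) = r *\<^sub>R g x" for r x by (rule inj) (simp add: Tg blinfun.scaleR_right)
    show "norm (g x) \<le> norm x * (1 / c)" for x
      using below[of "g x"] c by (simp add: Tg field_simps)
  qed
  then have app: "Blinfun g x = g x" for x by (simp add: bounded_linear_Blinfun_apply)
  show ?thesis
    by (rule invertible_opI[OF lin, of "Blinfun g"]; rule blinfun_eqI) (simp_all add: app Tg gT)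
qed

section \<open>The spectrum of a self-adjoint operator\<close>

definition real_spectrum :: "('a::complex_hilbert_space \<Rightarrow>\<^sub>L 'a) \<Rightarrow> real set"
  where "real_spectrum T = {x. complex_of_real x \<in> op_spectrum T}"

lemma scalar_op_of_real:
  "(scalar_op (complex_of_real r) :: 'a::complex_hilbert_space \<Rightarrow>\<^sub>L 'a) = r *\<^sub>R id_blinfun"
proof (rule blinfun_eqI)
  fix x :: 'a
  show "scalar_op (complex_of_real r) x = (r *\<^sub>R id_blinfun) x"
    unfolding scalar_op_def bounded_linear_Blinfun_apply[OF bounded_linear_scaleC]
    by (simp add: scaleC_of_real blinfun.scaleR_left)
qed

lemma real_spectrum_iff: "x \<in> real_spectrum T \<longleftrightarrow> \<not> invertible_op (T - x *\<^sub>R id_blinfun)"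
  by (simp add: real_spectrum_def op_spectrum_def scalar_op_of_real)

text \<open>Otherwise \<open>S\<^sup>2 - n\<^sup>2 = (S - n)(S + n)\<close> with \<open>n = \<parallel>S\<parallel>\<close> is invertible and hence bounded below. But
  \<open>\<parallel>(S\<^sup>2 - n\<^sup>2) x\<parallel>\<^sup>2 \<le> 2 n\<^sup>2 (n\<^sup>2 \<parallel>x\<parallel>\<^sup>2 - \<parallel>S x\<parallel>\<^sup>2)\<close>, so \<open>\<parallel>S x\<parallel>\<^sup>2 \<le> (n\<^sup>2 - \<delta>) \<parallel>x\<parallel>\<^sup>2\<close>
  for some \<open>\<delta> > 0\<close>, which contradicts the choice of \<open>n\<close>. On the zero space every operator is invertible
  and the spectrum is empty, whence the nontriviality hypothesis.\<close>

lemma norm_in_real_spectrum: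
  fixes S :: "'a::complex_hilbert_space \<Rightarrow>\<^sub>L 'a"
  assumes S: "selfadjoint_op S" and nontriv: "(id_blinfun :: 'a \<Rightarrow>\<^sub>L 'a) \<noteq> 0"
  shows "norm S \<in> real_spectrum S \<or> - norm S \<in> real_spectrum S"
proof (rule ccontr)
  define n where "n = norm S"
  assume "\<not> ?thesis"
  then have "invertible_op ((S - n *\<^sub>R id_blinfun) o\<^sub>L (S + n *\<^sub>R id_blinfun))"
    by (intro invertible_op_compose) (simp_all add: real_spectrum_iff n_def)
  also have "(S - n *\<^sub>R id_blinfun) o\<^sub>L (S + n *\<^sub>R id_blinfun) = (S o\<^sub>L S) - n\<^sup>2 *\<^sub>R id_blinfun"
    by (simp add: blinfun_compose_linear power2_eq_square scaleR_right_diff_distrib)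
  finally obtain k where k: "0 < k"
    and below: "\<And>x. norm x \<le> k * norm (((S o\<^sub>L S) - n\<^sup>2 *\<^sub>R id_blinfun) x)"
    using invertible_op_bounded_below by blast
  have bound: "norm (S x) \<le> n * norm x" for x by (simp add: n_def norm_blinfun)
  have gap: "(norm x)\<^sup>2 \<le> 2 * k\<^sup>2 * n\<^sup>2 * (n\<^sup>2 * (norm x)\<^sup>2 - (norm (S x))\<^sup>2)" for x
  proof -
    have "(norm (S (S x) - n\<^sup>2 *\<^sub>R x))\<^sup>2
        = (norm (S (S x)))\<^sup>2 - 2 * n\<^sup>2 * (norm (S x))\<^sup>2 + n ^ 4 * (norm x)\<^sup>2"
      by (simp add: norm_diff_power2 rinner_scaleR_right selfadjoint_op_rinner[OF S, of "S x"]
          rinner_self power_mult_distrib flip: power_mult)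
    moreover have "(norm (S (S x)))\<^sup>2 \<le> (n * (n * norm x))\<^sup>2"
      using order_trans[OF bound[of "S x"] mult_left_mono[OF bound[of x]]]
      by (intro power_mono) (simp_all add: n_def)
    ultimately have "(norm (S (S x) - n\<^sup>2 *\<^sub>R x))\<^sup>2
        \<le> 2 * n\<^sup>2 * (n\<^sup>2 * (norm x)\<^sup>2 - (norm (S x))\<^sup>2)"
      by (simp add: algebra_simps power2_eq_square power4_eq_xxxx)
    moreover have "(norm x)\<^sup>2 \<le> (k * norm (S (S x) - n\<^sup>2 *\<^sub>R x))\<^sup>2"
      using below[of x] by (intro power_mono) (simp_all add: blinfun.diff_left blinfun.scaleR_left)
    ultimately show ?thesis
      using mult_left_mono[of "(norm (S (S x) - n\<^sup>2 *\<^sub>R x))\<^sup>2" _ "k\<^sup>2"]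
      by (fastforce simp: power_mult_distrib mult_ac)
  qed
  have n: "0 < n"
  proof (rule ccontr)
    assume "\<not> 0 < n"
    then have "n = 0" by (simp add: n_def)
    then have zero: "x = 0" for x :: 'a using gap[of x] by simp
    have "(id_blinfun :: 'a \<Rightarrow>\<^sub>L 'a) x = (0 :: 'a \<Rightarrow>\<^sub>L 'a) x" for x
      using zero[of x] by simp
    then show False using nontriv blinfun_eqI by blast
  qed
  define \<delta> where "\<delta> = 1 / (2 * k\<^sup>2 * n\<^sup>2)"
  have \<delta>: "0 < \<delta>" using k n by (simp add: \<delta>_def)
  \<comment> \<open>The maximum spares a proof of \<open>\<delta> \<le> n\<^sup>2\<close>.\<close>
  have "norm (S x) \<le> sqrt (max 0 (n\<^sup>2 - \<delta>)) * norm x" for x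
  proof (rule power2_le_imp_le)
    have "\<delta> * (norm x)\<^sup>2 \<le> n\<^sup>2 * (norm x)\<^sup>2 - (norm (S x))\<^sup>2"
      using mult_left_mono[OF gap[of x], of \<delta>] k n \<delta> by (simp add: \<delta>_def)
    then have "(norm (S x))\<^sup>2 \<le> (n\<^sup>2 - \<delta>) * (norm x)\<^sup>2"
      by (simp add: left_diff_distrib)
    also have "\<dots> \<le> max 0 (n\<^sup>2 - \<delta>) * (norm x)\<^sup>2"
      by (rule mult_right_mono) simp_all
    also have "\<dots> = (sqrt (max 0 (n\<^sup>2 - \<delta>)) * norm x)\<^sup>2"
      by (simp add: power_mult_distrib)
    finally show "(norm (S x))\<^sup>2 \<le> (sqrt (max 0 (n\<^sup>2 - \<delta>)) * norm x)\<^sup>2" .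
  qed simp
  then have "n \<le> sqrt (max 0 (n\<^sup>2 - \<delta>))"
    unfolding n_def by (intro norm_blinfun_bound) simp_all
  also have "\<dots> < sqrt (n\<^sup>2)" using n \<delta> by (intro real_sqrt_less_mono) simp
  finally show False using n by simp
qed

section \<open>Polynomials in an operator\<close>

text \<open>Horner's recursion, through which all algebraic properties of \<open>poly_op\<close> follow by induction on
  the polynomial.\<close>

lemma poly_op_pCons: "poly_op (pCons a p) T = a *\<^sub>R id_blinfun + (T o\<^sub>L poly_op p T)"
proof -
  let ?pow = "\<lambda>i. ((\<lambda>S. T o\<^sub>L S) ^^ i) id_blinfun"
  have ext: "poly_op q T = (\<Sum>i\<le>n. coeff q i *\<^sub>R ?pow i)" if "degree q \<le> n" for q n
    unfolding poly_op_def using that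
    by (intro sum.mono_neutral_left) (auto simp: coeff_eq_0)
  have "poly_op (pCons a p) T = (\<Sum>i\<le>Suc (degree p). coeff (pCons a p) i *\<^sub>R ?pow i)"
    by (rule ext) (simp add: degree_pCons_le)
  also have "\<dots> = a *\<^sub>R id_blinfun + (\<Sum>i\<le>degree p. coeff p i *\<^sub>R (T o\<^sub>L ?pow i))"
    unfolding sum.atMost_Suc_shift by simp
  also have "(\<Sum>i\<le>degree p. coeff p i *\<^sub>R (T o\<^sub>L ?pow i)) = T o\<^sub>L poly_op p T"
    unfolding poly_op_def
    by (simp add: bounded_bilinear.sum_right[OF bounded_bilinear_blinfun_compose]
        blinfun_compose_linear)
  finally show ?thesis .
qed

lemma poly_op_0 [simp]: "poly_op 0 T = 0"
  by (simp add: poly_op_def)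

lemma poly_op_add: "poly_op (p + q) T = poly_op p T + poly_op q T"
  by (induction p q rule: poly_induct2)
    (simp_all add: poly_op_pCons blinfun_compose_linear scaleR_left_distrib)

lemma poly_op_smult: "poly_op (smult c p) T = c *\<^sub>R poly_op p T"
  by (induction p) (simp_all add: poly_op_pCons blinfun_compose_linear scaleR_right_distrib)

lemma poly_op_diff: "poly_op (p - q) T = poly_op p T - poly_op q T"
  using poly_op_add[of p "smult (-1) q" T] poly_op_smult[of "-1" q T] by simp

lemma poly_op_mult: "poly_op (p * q) T = poly_op p T o\<^sub>L poly_op q T"
  by (induction p)
    (simp_all add: poly_op_pCons poly_op_add poly_op_smult blinfun_compose_linear
      blinfun_compose_assoc)

lemma poly_op_const: "poly_op [:c:] T = c *\<^sub>R id_blinfun"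
  by (simp add: poly_op_pCons)

lemma poly_op_X: "poly_op [:0, 1:] T = T"
  by (simp add: poly_op_pCons)

lemma poly_op_commute:
  assumes "X o\<^sub>L T = T o\<^sub>L X"
  shows "X o\<^sub>L poly_op p T = poly_op p T o\<^sub>L X"
proof (induction p)
  case (pCons a p)
  have "X o\<^sub>L (T o\<^sub>L poly_op p T) = T o\<^sub>L (X o\<^sub>L poly_op p T)"
    using assms by (metis blinfun_compose_assoc)
  then show ?case using pCons.IH
    by (simp add: poly_op_pCons blinfun_compose_linear blinfun_compose_assoc)
qed simp

lemma selfadjoint_poly_op:
  assumes "selfadjoint_op T"
  shows "selfadjoint_op (poly_op p T)"
proof (induction p)
  case 0
  then show ?case using selfadjoint_op_scaleR[OF assms, of 0] by simp
next
  case (pCons a p)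
  then show ?case unfolding poly_op_pCons
    by (intro selfadjoint_op_add selfadjoint_op_scaleR selfadjoint_op_id selfadjoint_op_compose
        assms poly_op_commute refl)
qed

text \<open>A complex root of \<open>q\<close> is either real, giving a linear factor, or nonreal of the form
  \<open>a + b \<i>\<close>, giving the factor \<open>(x - a)\<^sup>2 + b\<^sup>2\<close>: the remainder of \<open>q\<close> modulo it is a real polynomial
  of degree at most one with a nonreal root, hence zero.\<close>

lemma real_poly_factor_cases:
  fixes q :: "real poly"
  assumes "0 < degree q"
  obtains (linear) a r where "q = [:- a, 1:] * r"
  | (quadratic) a b r where "b \<noteq> 0" and "q = [:a\<^sup>2 + b\<^sup>2, - 2 * a, 1:] * r"
proof -
  \<comment> \<open>Evaluation of a real polynomial at a complex point, a ring homomorphism.\<close>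
  define ev where "ev p z = poly (map_poly complex_of_real p) z" for p z
  have ev_pCons: "ev (pCons c p) z = of_real c + z * ev p z" for c p z
    by (simp add: ev_def map_poly_pCons)
  have ev_0: "ev 0 z = 0" for z by (simp add: ev_def)
  have ev_add: "ev (p + p') z = ev p z + ev p' z" for p p' z
    unfolding ev_def poly_add[symmetric]
    by (rule arg_cong[where f = "\<lambda>p. poly p z"], rule poly_eqI) (simp add: coeff_map_poly)
  have ev_mult: "ev (p * p') z = ev p z * ev p' z" for p p' z
    unfolding ev_def poly_mult[symmetric]
    by (rule arg_cong[where f = "\<lambda>p. poly p z"], rule poly_eqI)
      (simp add: coeff_map_poly coeff_mult)
  have ev_real: "ev p (of_real x) = of_real (poly p x)" for p x
    by (induction p) (simp_all add: ev_0 ev_pCons)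
  have "\<not> constant (poly (map_poly complex_of_real q))"
    using assms by (simp add: constant_degree degree_map_poly)
  then obtain z where z: "ev q z = 0"
    using fundamental_theorem_of_algebra by (auto simp: ev_def)
  define a b where "a = Re z" and "b = Im z"
  have zab: "z = Complex a b" by (simp add: a_def b_def)
  show ?thesis
  proof (cases "b = 0")
    case True
    then have "z = of_real a" by (simp add: zab complex_of_real_def)
    then have "poly q a = 0" using z ev_real by simp
    then show ?thesis using linear by (auto simp: poly_eq_0_iff_dvd elim: dvdE)
  next
    case False
    let ?d = "[:a\<^sup>2 + b\<^sup>2, - 2 * a, 1:]"
    have d0: "ev ?d z = 0"
      by (simp add: ev_pCons ev_0 zab complex_eq_iff power2_eq_square algebra_simps)
    have qd: "q = ?d * (q div ?d) + q mod ?d" by (rule mult_div_mod_eq[symmetric])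
    have "degree (q mod ?d) < 2"
      using degree_mod_less[of ?d q] by auto
    define u v where "u = coeff (q mod ?d) 0" and "v = coeff (q mod ?d) 1"
    have uv: "q mod ?d = [:u, v:]"
    proof (rule poly_eqI)
      fix i
      show "coeff (q mod ?d) i = coeff [:u, v:] i"
        using \<open>degree (q mod ?d) < 2\<close>
        by (cases i; cases "i - 1") (simp_all add: u_def v_def coeff_eq_0)
    qed
    have ev_uv: "ev [:u, v:] z = 0"
      using z d0 ev_add[of "?d * (q div ?d)" "q mod ?d" z] ev_mult[of ?d "q div ?d" z] uv qd by simp
    then have "v = 0" using False by (simp add: ev_pCons ev_0 zab complex_eq_iff)
    moreover from this have "u = 0" using ev_uv by (simp add: ev_pCons ev_0)
    ultimately show ?thesis using quadratic[OF False, of a "q div ?d"] qd uv by simp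
  qed
qed

text \<open>One inclusion of the spectral mapping theorem, by splitting off one real factor at a
  time. A linear factor \<open>x - a\<close> has its root off the spectrum. A factor \<open>(x - b)\<^sup>2 + a\<^sup>2\<close> gives the
  operator \<open>(T - b)\<^sup>2 + a\<^sup>2\<close>, which is coercive because \<open>T - b\<close> is self-adjoint; thus nonreal spectrum
  never has to be considered.\<close>

lemma invertible_poly_op:
  assumes T: "selfadjoint_op T" and "q \<noteq> 0"
    and "\<And>x. x \<in> real_spectrum T \<Longrightarrow> poly q x \<noteq> 0"
  shows "invertible_op (poly_op q T)"
  using assms(2,3)
proof (induction "degree q" arbitrary: q rule: less_induct)
  case less
  show ?case
  proof (cases "degree q = 0")
    case True
    then obtain c where "q = [:c:]" by (metis degree_eq_zeroE)
    moreover have "invertible_op (id_blinfun :: 'a \<Rightarrow>\<^sub>L 'a)"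
      by (rule invertible_opI[of _ id_blinfun]) (simp_all add: complex_linear_id)
    ultimately show ?thesis
      using less.prems by (simp add: poly_op_const invertible_op_scaleR)
  next
    case False
    have step: ?thesis if q: "q = d * r" and d: "0 < degree d" "invertible_op (poly_op d T)" for d r
    proof -
      have "d \<noteq> 0" "r \<noteq> 0" using less.prems q by auto
      then have "invertible_op (poly_op r T)"
        using less.prems q d by (intro less.hyps) (auto simp: degree_mult_eq)
      then show ?thesis using d q by (simp add: poly_op_mult invertible_op_compose)
    qed
    from False have "0 < degree q" by simp
    then show ?thesis
    proof (cases rule: real_poly_factor_cases)
      case (linear a r)
      then have "a \<notin> real_spectrum T" using less.prems(2)[of a] by auto
      then show ?thesis
        using linear by (intro step[of "[:- a, 1:]" r]) (simp_all add: real_spectrum_iff poly_op_pCons)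
    next
      case (quadratic b a r)
      let ?d = "[:b\<^sup>2 + a\<^sup>2, - 2 * b, 1:]"
      have "invertible_op (poly_op ?d T)"
      proof (rule invertible_op_coercive)
        show "complex_linear (poly_op ?d T)"
          by (intro selfadjoint_op_linear selfadjoint_poly_op T)
        show "0 < a\<^sup>2" using quadratic by simp
        fix x
        have "poly_op ?d T x = T (T x) - (2 * b) *\<^sub>R T x + (b\<^sup>2 + a\<^sup>2) *\<^sub>R x"
          by (simp add: poly_op_pCons blinfun.add_left blinfun.scaleR_left blinfun.add_right
              blinfun.scaleR_right blinfun.diff_left blinfun.diff_right)
        then have "rinner (poly_op ?d T x) x = (norm (T x - b *\<^sub>R x))\<^sup>2 + a\<^sup>2 * (norm x)\<^sup>2"
          by (simp add: norm_diff_power2 rinner_linear rinner_self power_mult_distrib distrib_right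
              selfadjoint_op_rinner[OF T, of "T x"])
        then show "a\<^sup>2 * (norm x)\<^sup>2 \<le> rinner (poly_op ?d T x) x" by simp
      qed
      then show ?thesis using quadratic by (intro step[of ?d r]) simp_all
    qed
  qed
qed

text \<open>On a nonzero space, one of \<open>s = \<plusminus>\<parallel>p(T)\<parallel>\<close> lies in the spectrum of \<open>p(T)\<close>, so \<open>p(T) - s\<close> is not invertible and
  \<open>p\<close> takes the value \<open>s\<close> on the spectrum of \<open>T\<close>. If \<open>p\<close> is the constant \<open>s\<close>, that value is taken because
  the spectrum of \<open>T\<close> is nonempty. The bound \<open>e\<close> is used in place of a supremum, which would be
  meaningless when the spectrum is empty.\<close>

lemma norm_poly_op_le:
  fixes T :: "'a::complex_hilbert_space \<Rightarrow>\<^sub>L 'a"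
  assumes T: "selfadjoint_op T" and e: "0 \<le> e"
    and le: "\<And>x. x \<in> real_spectrum T \<Longrightarrow> \<bar>poly p x\<bar> \<le> e"
  shows "norm (poly_op p T) \<le> e"
proof (cases "(id_blinfun :: 'a \<Rightarrow>\<^sub>L 'a) = 0")
  case True
  then have "poly_op p T = 0" by (metis blinfun_compose_id(1) blinfun_compose_zero(1))
  then show ?thesis using e by simp
next
  case False
  obtain s where "s = norm (poly_op p T) \<or> s = - norm (poly_op p T)"
    and s: "s \<in> real_spectrum (poly_op p T)"
    using norm_in_real_spectrum[OF selfadjoint_poly_op[OF T] False, of p] by blast
  then have s_abs: "\<bar>s\<bar> = norm (poly_op p T)" by auto
  have "\<exists>x\<in>real_spectrum T. poly (p - [:s:]) x = 0"
  proof (cases "p - [:s:] = 0")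
    case True
    then show ?thesis using norm_in_real_spectrum[OF T False] by fastforce
  next
    case False
    then show ?thesis
      using invertible_poly_op[OF T False] s
      by (metis poly_op_const poly_op_diff real_spectrum_iff)
  qed
  then show ?thesis using le s_abs by fastforce
qed

section \<open>Continuous functional calculus\<close>

lemma poly_op_tendsto_0:
  assumes T: "selfadjoint_op T"
    and lim: "uniform_limit (real_spectrum T) (\<lambda>n. poly (p n)) (\<lambda>_. 0) sequentially"
  shows "(\<lambda>n. poly_op (p n) T) \<longlonglongrightarrow> 0"
proof (rule tendstoI)
  fix e :: real
  assume e: "0 < e"
  then have "\<forall>\<^sub>F n in sequentially. \<forall>x\<in>real_spectrum T. dist (poly (p n) x) 0 < e / 2"
    using lim by (intro uniform_limitD) simp_all
  then show "\<forall>\<^sub>F n in sequentially. dist (poly_op (p n) T) 0 < e"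
  proof eventually_elim
    case (elim n)
    then have "norm (poly_op (p n) T) \<le> e / 2"
      using e by (intro norm_poly_op_le T) (auto intro: less_imp_le)
    then show ?case using e by simp
  qed
qed

text \<open>Uniqueness of the limit: if two sequences of polynomials have the same uniform limit on the
  spectrum, their difference tends to zero there, and so do the corresponding operators.\<close>

lemma cfc_eqI:
  assumes T: "selfadjoint_op T"
    and unif: "uniform_limit (real_spectrum T) (\<lambda>n. poly (p n)) f sequentially"
    and lim: "(\<lambda>n. poly_op (p n) T) \<longlonglongrightarrow> S"
  shows "cfc f T = S"
  unfolding cfc_def real_spectrum_def[symmetric]
proof (rule the_equality)
  fix S'
  assume "\<exists>q. uniform_limit (real_spectrum T) (\<lambda>n. poly (q n)) f sequentially \<and>
      (\<lambda>n. poly_op (q n) T) \<longlonglongrightarrow> S'"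
  then obtain q where q: "uniform_limit (real_spectrum T) (\<lambda>n. poly (q n)) f sequentially"
    and lim': "(\<lambda>n. poly_op (q n) T) \<longlonglongrightarrow> S'" by blast
  have "uniform_limit (real_spectrum T) (\<lambda>n. poly (q n - p n)) (\<lambda>_. 0) sequentially"
    using uniform_limit_minus[OF q unif] by (simp add: poly_diff[abs_def])
  then have "(\<lambda>n. poly_op (q n - p n) T) \<longlonglongrightarrow> 0"
    by (rule poly_op_tendsto_0[OF T])
  moreover have "(\<lambda>n. poly_op (q n - p n) T) \<longlonglongrightarrow> S' - S"
    unfolding poly_op_diff by (intro tendsto_diff lim lim')
  ultimately have "S' - S = 0" by (metis LIMSEQ_unique)
  then show "S' = S" by simp
qed (use unif lim in blast)

lemma cfc_poly: "selfadjoint_op T \<Longrightarrow> cfc (poly p) T = poly_op p T"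
  by (rule cfc_eqI[where p = "\<lambda>_. p"]) (simp_all add: uniform_limit_const)

lemma cfc_cong:
  assumes "\<And>x. x \<in> real_spectrum T \<Longrightarrow> f x = g x"
  shows "cfc f T = cfc g T"
proof -
  have "uniform_limit (real_spectrum T) h f F \<longleftrightarrow> uniform_limit (real_spectrum T) h g F"
    for h :: "nat \<Rightarrow> real \<Rightarrow> real" and F
    using assms by (intro uniform_limit_cong') auto
  then show ?thesis unfolding cfc_def real_spectrum_def[symmetric] by simp
qed

lemma continuous_on_interval_uniform_limit_poly:
  fixes f :: "real \<Rightarrow> real"
  assumes "continuous_on {a..b} f"
  obtains p where "uniform_limit {a..b} (\<lambda>n. poly (p n)) f sequentially"
proof -
  have "\<exists>p. \<forall>x\<in>{a..b}. \<bar>f x - poly p x\<bar> < inverse (real (Suc n))" for n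
  proof -
    obtain g where g: "real_polynomial_function g"
      and close: "\<And>x. x \<in> {a..b} \<Longrightarrow> \<bar>f x - g x\<bar> < inverse (real (Suc n))"
      using Stone_Weierstrass_real_polynomial_function[of "{a..b}" f "inverse (real (Suc n))"] assms
      by auto
    obtain c k where "g = (\<lambda>x. \<Sum>i\<le>k. c i * x ^ i)"
      using g real_polynomial_function_iff_sum by blast
    then have "g = poly (\<Sum>i\<le>k. monom (c i) i)"
      by (simp add: fun_eq_iff poly_sum poly_monom)
    then show ?thesis using close by blast
  qed
  then obtain p where p: "\<And>n x. x \<in> {a..b} \<Longrightarrow> \<bar>f x - poly (p n) x\<bar> < inverse (real (Suc n))"
    by metis
  have "uniform_limit {a..b} (\<lambda>n. poly (p n)) f sequentially"
  proof (rule uniform_limitI)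
    fix e :: real
    assume "0 < e"
    then obtain N where N: "inverse (real (Suc N)) < e" using reals_Archimedean by blast
    show "\<forall>\<^sub>F n in sequentially. \<forall>x\<in>{a..b}. dist (poly (p n) x) (f x) < e"
    proof (rule eventually_sequentiallyI[of N], rule ballI)
      fix n x
      assume "N \<le> n" and x: "x \<in> {a..b}"
      then have "inverse (real (Suc n)) \<le> inverse (real (Suc N))"
        by (intro le_imp_inverse_le) simp_all
      then have "\<bar>f x - poly (p n) x\<bar> < e" using p[OF x, of n] N by linarith
      then show "dist (poly (p n) x) (f x) < e" by (simp add: dist_real_def abs_minus_commute)
    qed
  qed
  then show ?thesis by (rule that)
qed

text \<open>Existence of the limit. Weierstrass approximation takes place on an interval around the
  spectrum, and \<open>norm_poly_op_le\<close> turns uniform convergence on the spectrum into a Cauchy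
  sequence of operators. All properties of the calculus are transferred from polynomials
  through the sequence obtained here.\<close>

lemma cfc_approx:
  assumes T: "selfadjoint_op T" and spec: "real_spectrum T \<subseteq> {a..b}"
    and f: "continuous_on {a..b} f"
  obtains p where "uniform_limit (real_spectrum T) (\<lambda>n. poly (p n)) f sequentially"
    and "(\<lambda>n. poly_op (p n) T) \<longlonglongrightarrow> cfc f T"
proof -
  obtain p where "uniform_limit {a..b} (\<lambda>n. poly (p n)) f sequentially"
    using continuous_on_interval_uniform_limit_poly[OF f] .
  then have p: "uniform_limit (real_spectrum T) (\<lambda>n. poly (p n)) f sequentially"
    using spec by (rule uniform_limit_on_subset)
  have "Cauchy (\<lambda>n. poly_op (p n) T)"
  proof (rule metric_CauchyI)
    fix e :: real
    assume e: "0 < e"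
    then have "\<forall>\<^sub>F n in sequentially. \<forall>x\<in>real_spectrum T. dist (poly (p n) x) (f x) < e / 4"
      using p by (intro uniform_limitD) simp_all
    then obtain N where N: "\<And>n x. N \<le> n \<Longrightarrow> x \<in> real_spectrum T \<Longrightarrow> dist (poly (p n) x) (f x) < e / 4"
      by (auto simp: eventually_sequentially)
    have "dist (poly_op (p m) T) (poly_op (p n) T) < e" if "N \<le> m" "N \<le> n" for m n
    proof -
      have "norm (poly_op (p m - p n) T) \<le> e / 2"
      proof (rule norm_poly_op_le[OF T])
        fix x
        assume x: "x \<in> real_spectrum T"
        show "\<bar>poly (p m - p n) x\<bar> \<le> e / 2"
          using N[OF that(1) x] N[OF that(2) x] unfolding dist_real_def poly_diff by arith
      qed (use e in simp)
      then show ?thesis using e by (simp add: dist_norm poly_op_diff)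
    qed
    then show "\<exists>N. \<forall>m\<ge>N. \<forall>n\<ge>N. dist (poly_op (p m) T) (poly_op (p n) T) < e" by blast
  qed
  then obtain S where S: "(\<lambda>n. poly_op (p n) T) \<longlonglongrightarrow> S"
    using Cauchy_convergent convergent_def by blast
  with cfc_eqI[OF T p S] p that show ?thesis by blast
qed

lemma selfadjoint_cfc:
  assumes "selfadjoint_op T" and "real_spectrum T \<subseteq> {a..b}" and "continuous_on {a..b} f"
  shows "selfadjoint_op (cfc f T)"
  using cfc_approx[OF assms] selfadjoint_op_limit selfadjoint_poly_op[OF assms(1)] by metis

lemma cfc_commute:
  assumes "selfadjoint_op T" and "real_spectrum T \<subseteq> {a..b}" and "continuous_on {a..b} f"
    and X: "X o\<^sub>L T = T o\<^sub>L X"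
  shows "X o\<^sub>L cfc f T = cfc f T o\<^sub>L X"
proof -
  obtain p where p: "(\<lambda>n. poly_op (p n) T) \<longlonglongrightarrow> cfc f T"
    using cfc_approx[OF assms(1-3)] by blast
  have "(\<lambda>n. X o\<^sub>L poly_op (p n) T) \<longlonglongrightarrow> (X o\<^sub>L cfc f T)"
    by (intro bounded_bilinear.tendsto[OF bounded_bilinear_blinfun_compose] p tendsto_const)
  moreover have "(\<lambda>n. poly_op (p n) T o\<^sub>L X) \<longlonglongrightarrow> (cfc f T o\<^sub>L X)"
    by (intro bounded_bilinear.tendsto[OF bounded_bilinear_blinfun_compose] p tendsto_const)
  ultimately show ?thesis unfolding poly_op_commute[OF X] by (rule LIMSEQ_unique)
qed

lemma cfc_mult:
  assumes T: "selfadjoint_op T" and spec: "real_spectrum T \<subseteq> {a..b}"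
    and f: "continuous_on {a..b} f" and g: "continuous_on {a..b} g"
  shows "cfc (\<lambda>x. f x * g x) T = cfc f T o\<^sub>L cfc g T"
proof -
  obtain p where p: "uniform_limit (real_spectrum T) (\<lambda>n. poly (p n)) f sequentially"
    "(\<lambda>n. poly_op (p n) T) \<longlonglongrightarrow> cfc f T"
    using cfc_approx[OF T spec f] .
  obtain q where q: "uniform_limit (real_spectrum T) (\<lambda>n. poly (q n)) g sequentially"
    "(\<lambda>n. poly_op (q n) T) \<longlonglongrightarrow> cfc g T"
    using cfc_approx[OF T spec g] .
  have bd: "bounded (h ` real_spectrum T)" if "continuous_on {a..b} h" for h :: "real \<Rightarrow> real"
  proof (rule bounded_subset)
    show "bounded (h ` {a..b})"
      using that by (intro compact_imp_bounded compact_continuous_image) simp_all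
  qed (use spec in blast)
  show ?thesis
  proof (rule cfc_eqI[OF T])
    show "uniform_limit (real_spectrum T) (\<lambda>n. poly (p n * q n)) (\<lambda>x. f x * g x) sequentially"
      using uniform_lim_mult[OF p(1) q(1) bd[OF f] bd[OF g]] by (simp add: poly_mult[abs_def])
    show "(\<lambda>n. poly_op (p n * q n) T) \<longlonglongrightarrow> (cfc f T o\<^sub>L cfc g T)"
      unfolding poly_op_mult
      by (intro bounded_bilinear.tendsto[OF bounded_bilinear_blinfun_compose] p q)
  qed
qed

section \<open>Real powers of positive definite operators\<close>

lemma posdef_op_selfadjoint: "posdef_op T \<Longrightarrow> selfadjoint_op T"
  by (simp add: posdef_op_def positive_op_def)

text \<open>The Cauchy--Schwarz inequality for the form \<open>\<langle>T x, y\<rangle>\<close>, at \<open>x\<close> and \<open>T x\<close>, gives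
  \<open>\<parallel>T x\<parallel>\<^sup>2 \<le> \<parallel>T\<parallel> \<langle>T x, x\<rangle>\<close>, and invertibility bounds \<open>\<parallel>T x\<parallel>\<close> below by a multiple of \<open>\<parallel>x\<parallel>\<close>.\<close>

lemma posdef_op_coercive:
  assumes T: "posdef_op T"
  obtains c where "0 < c" and "\<And>x. c * (norm x)\<^sup>2 \<le> rinner (T x) x"
proof -
  have sa: "selfadjoint_op T" and nonneg: "\<And>x. 0 \<le> rinner (T x) x" and inv: "invertible_op T"
    using T by (auto simp: posdef_op_def positive_op_iff_rinner)
  obtain k where k: "0 < k" "\<And>x. norm x \<le> k * norm (T x)"
    using invertible_op_bounded_below[OF inv] by blast
  have sym: "rinner (T x) y = rinner (T y) x" for x y
    by (metis selfadjoint_op_rinner[OF sa] rinner_commute)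
  \<comment> \<open>The summand \<open>1\<close> keeps \<open>c\<close> positive when \<open>T = 0\<close>, which is possible on the zero space.\<close>
  define c where "c = 1 / (k\<^sup>2 * (norm T + 1))"
  have pos: "0 < norm T + 1" by (simp add: add_nonneg_pos)
  have "(norm x)\<^sup>2 \<le> k\<^sup>2 * (norm T + 1) * rinner (T x) x" for x
  proof -
    have "(rinner (T x) (T x))\<^sup>2 \<le> rinner (T x) x * rinner (T (T x)) (T x)"
      by (rule semidefinite_form_Cauchy_Schwarz[where b = "\<lambda>x y. rinner (T x) y"])
        (fact sym nonneg | simp add: blinfun.add_right blinfun.scaleR_right rinner_linear)+
    also have "rinner (T (T x)) (T x) \<le> (norm T + 1) * rinner (T x) (T x)"
    proof -
      have "rinner (T (T x)) (T x) \<le> norm (T (T x)) * norm (T x)" by (rule rinner_le_norm)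
      also have "\<dots> \<le> (norm T * norm (T x)) * norm (T x)"
        by (intro mult_right_mono norm_blinfun) simp
      also have "\<dots> \<le> (norm T + 1) * rinner (T x) (T x)"
        by (simp add: rinner_self power2_eq_square distrib_right)
      finally show ?thesis .
    qed
    finally have "(rinner (T x) (T x))\<^sup>2
        \<le> rinner (T x) x * ((norm T + 1) * rinner (T x) (T x))"
      using nonneg[of x] by (simp add: mult_left_mono)
    then have "rinner (T x) (T x) * rinner (T x) (T x)
        \<le> ((norm T + 1) * rinner (T x) x) * rinner (T x) (T x)"
      by (simp add: power2_eq_square mult_ac)
    then have "(norm (T x))\<^sup>2 \<le> (norm T + 1) * rinner (T x) x"
    proof (cases "T x = 0")
      case False
      then have "0 < rinner (T x) (T x)" by (simp add: rinner_self)
      then show ?thesis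
        using mult_right_le_imp_le \<open>rinner (T x) (T x) * rinner (T x) (T x) \<le> _\<close>
        by (metis rinner_self)
    qed (use nonneg[of x] pos in simp)
    moreover have "(norm x)\<^sup>2 \<le> (k * norm (T x))\<^sup>2" using k by (intro power_mono) simp_all
    ultimately show ?thesis
      using mult_left_mono[of "(norm (T x))\<^sup>2" "(norm T + 1) * rinner (T x) x" "k\<^sup>2"]
      by (simp add: power_mult_distrib mult.assoc)
  qed
  then have "c * (norm x)\<^sup>2 \<le> c * (k\<^sup>2 * (norm T + 1) * rinner (T x) x)" for x
    using k pos by (intro mult_left_mono) (simp_all add: c_def)
  moreover have "c * (k\<^sup>2 * (norm T + 1) * r) = r" for r
    using k pos by (simp add: c_def)
  ultimately have "c * (norm x)\<^sup>2 \<le> rinner (T x) x" for x by simp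
  moreover have "0 < c" using k pos by (simp add: c_def)
  ultimately show ?thesis using that by blast
qed

text \<open>The spectrum stays away from zero, so every real power is continuous on an interval
  containing it and the functional calculus applies.\<close>

lemma posdef_op_spectrum:
  assumes T: "posdef_op T"
  obtains m M where "0 < m" and "real_spectrum T \<subseteq> {m..M}"
proof -
  have sa: "selfadjoint_op T" using T by (rule posdef_op_selfadjoint)
  obtain m where m: "0 < m" "\<And>x. m * (norm x)\<^sup>2 \<le> rinner (T x) x"
    using posdef_op_coercive[OF T] by blast
  have upper: "rinner (T x) x \<le> norm T * (norm x)\<^sup>2" for x
    using order_trans[OF rinner_le_norm mult_right_mono[OF norm_blinfun norm_ge_zero]]
    by (simp add: power2_eq_square mult.assoc)
  have "invertible_op (T - z *\<^sub>R id_blinfun)" if "z < m" for z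
  proof (rule invertible_op_coercive[where c = "m - z"])
    show "complex_linear (T - z *\<^sub>R id_blinfun)"
      by (intro selfadjoint_op_linear selfadjoint_op_diff selfadjoint_op_scaleR selfadjoint_op_id sa)
    show "(m - z) * (norm x)\<^sup>2 \<le> rinner ((T - z *\<^sub>R id_blinfun) x) x" for x
      using m(2)[of x]
      by (simp add: blinfun.diff_left blinfun.scaleR_left rinner_linear rinner_self left_diff_distrib)
  qed (use that in simp)
  moreover have "invertible_op (T - z *\<^sub>R id_blinfun)" if "norm T < z" for z
  proof -
    have "invertible_op (z *\<^sub>R id_blinfun - T)"
    proof (rule invertible_op_coercive[where c = "z - norm T"])
      show "complex_linear (z *\<^sub>R id_blinfun - T)"
        by (intro selfadjoint_op_linear selfadjoint_op_diff selfadjoint_op_scaleR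
            selfadjoint_op_id sa)
      show "(z - norm T) * (norm x)\<^sup>2 \<le> rinner ((z *\<^sub>R id_blinfun - T) x) x" for x
        using upper[of x]
        by (simp add: blinfun.diff_left blinfun.scaleR_left rinner_linear rinner_self
            left_diff_distrib)
    qed (use that in simp)
    from invertible_op_scaleR[OF this, of "-1"] show ?thesis by simp
  qed
  ultimately have "real_spectrum T \<subseteq> {m..norm T}"
    by (auto simp: real_spectrum_iff not_less[symmetric])
  then show ?thesis using m(1) that by blast
qed

lemma selfadjoint_op_powr:
  assumes "posdef_op T"
  shows "selfadjoint_op (T powr\<^sub>L s)"
proof -
  obtain m M where m: "0 < m" "real_spectrum T \<subseteq> {m..M}" using posdef_op_spectrum[OF assms] .
  show ?thesis unfolding op_powr_def
    by (rule selfadjoint_cfc[OF posdef_op_selfadjoint[OF assms] m(2)])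
      (use m in \<open>auto intro!: continuous_intros\<close>)
qed

lemma op_powr_add:
  assumes "posdef_op T"
  shows "T powr\<^sub>L (s + r) = T powr\<^sub>L s o\<^sub>L T powr\<^sub>L r"
proof -
  obtain m M where m: "0 < m" "real_spectrum T \<subseteq> {m..M}" using posdef_op_spectrum[OF assms] .
  have cont: "continuous_on {m..M} (\<lambda>x. x powr s)" for s
    using m by (auto intro!: continuous_intros)
  show ?thesis
    unfolding op_powr_def powr_add
    by (rule cfc_mult[OF posdef_op_selfadjoint[OF assms] m(2) cont cont])
qed

lemma op_powr_commute:
  assumes "posdef_op T" and "X o\<^sub>L T = T o\<^sub>L X"
  shows "X o\<^sub>L T powr\<^sub>L s = T powr\<^sub>L s o\<^sub>L X"
proof -
  obtain m M where m: "0 < m" "real_spectrum T \<subseteq> {m..M}" using posdef_op_spectrum[OF assms(1)] .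
  show ?thesis unfolding op_powr_def
    by (rule cfc_commute[OF posdef_op_selfadjoint[OF assms(1)] m(2) _ assms(2)])
      (use m in \<open>auto intro!: continuous_intros\<close>)
qed

lemma op_powr_zero:
  assumes "posdef_op T"
  shows "T powr\<^sub>L 0 = id_blinfun"
proof -
  obtain m M where m: "0 < m" "real_spectrum T \<subseteq> {m..M}" using posdef_op_spectrum[OF assms] .
  have "cfc (\<lambda>x. x powr 0) T = cfc (poly [:1:]) T"
    by (rule cfc_cong) (use m in auto)
  then show ?thesis
    using cfc_poly[OF posdef_op_selfadjoint[OF assms]] by (simp add: op_powr_def poly_op_const)
qed

lemma op_powr_one:
  assumes "posdef_op T"
  shows "T powr\<^sub>L 1 = T"
proof -
  obtain m M where m: "0 < m" "real_spectrum T \<subseteq> {m..M}" using posdef_op_spectrum[OF assms] .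
  have "cfc (\<lambda>x. x powr 1) T = cfc (poly [:0, 1:]) T"
    by (rule cfc_cong) (use m in auto)
  then show ?thesis
    using cfc_poly[OF posdef_op_selfadjoint[OF assms]] by (simp add: op_powr_def poly_op_X)
qed

lemma op_powr_uminus:
  assumes "posdef_op T"
  shows "T powr\<^sub>L (- s) o\<^sub>L T powr\<^sub>L s = id_blinfun" "T powr\<^sub>L s o\<^sub>L T powr\<^sub>L (- s) = id_blinfun"
  using assms by (simp_all add: op_powr_zero flip: op_powr_add)

lemma posdef_op_conj:
  assumes S: "selfadjoint_op S" "invertible_op S" and T: "posdef_op T"
  shows "posdef_op (S o\<^sub>L T o\<^sub>L S)"
  using assms
  by (auto simp: posdef_op_def positive_op_iff_rinner selfadjoint_op_conj invertible_op_compose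
      selfadjoint_op_rinner[of S])

lemma invertible_op_powr:
  assumes "posdef_op T"
  shows "invertible_op (T powr\<^sub>L s)"
  by (rule invertible_opI[OF _ op_powr_uminus[OF assms]])
    (simp add: selfadjoint_op_linear selfadjoint_op_powr assms)

text \<open>Positivity because \<open>T^s\<close> is the square of the self-adjoint operator \<open>T^(s/2)\<close>.\<close>

lemma posdef_op_powr:
  assumes T: "posdef_op T"
  shows "posdef_op (T powr\<^sub>L s)"
proof -
  have "T powr\<^sub>L s = T powr\<^sub>L (s / 2) o\<^sub>L T powr\<^sub>L (s / 2)"
    using op_powr_add[OF T, of "s / 2" "s / 2"] by simp
  then have "0 \<le> rinner ((T powr\<^sub>L s) x) x" for x
    by (simp add: selfadjoint_op_rinner[OF selfadjoint_op_powr[OF T]] rinner_self)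
  then show ?thesis
    using T by (simp add: posdef_op_def positive_op_iff_rinner selfadjoint_op_powr invertible_op_powr)
qed

lemma posdef_op_add:
  assumes S: "posdef_op S" and T: "posdef_op T"
  shows "posdef_op (S + T)"
proof -
  have sa: "selfadjoint_op (S + T)" using S T by (intro selfadjoint_op_add posdef_op_selfadjoint)
  obtain c where c: "0 < c" "\<And>x. c * (norm x)\<^sup>2 \<le> rinner (S x) x"
    using posdef_op_coercive[OF S] by blast
  have T0: "0 \<le> rinner (T x) x" for x using T by (simp add: posdef_op_def positive_op_iff_rinner)
  have coer: "c * (norm x)\<^sup>2 \<le> rinner ((S + T) x) x" for x
    using c(2)[of x] T0[of x] by (simp add: blinfun.add_left rinner_linear)
  have "invertible_op (S + T)"
    by (rule invertible_op_coercive[OF selfadjoint_op_linear[OF sa] c(1) coer])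
  moreover have "0 \<le> rinner ((S + T) x) x" for x
    using coer[of x] c(1) by (meson order_trans mult_nonneg_nonneg less_imp_le zero_le_power2)
  ultimately show ?thesis using sa by (simp add: posdef_op_def positive_op_iff_rinner)
qed

text \<open>Let \<open>P\<close> be the square root given by the functional calculus. As a limit of polynomials in
  \<open>S = Q\<^sup>2\<close> it commutes with \<open>Q\<close>, so \<open>(P + Q)(P - Q) = P\<^sup>2 - Q\<^sup>2 = 0\<close>, and \<open>P + Q\<close> is invertible.\<close>

lemma op_powr_half_eqI:
  assumes S: "posdef_op S" and Q: "posdef_op Q" and sq: "Q o\<^sub>L Q = S"
  shows "S powr\<^sub>L (1/2) = Q"
proof -
  define P where "P = S powr\<^sub>L (1/2)"
  have PP: "P o\<^sub>L P = S"
    using op_powr_add[OF S, of "1/2" "1/2"] op_powr_one[OF S] by (simp add: P_def)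
  have "Q o\<^sub>L S = S o\<^sub>L Q" using sq by (metis blinfun_compose_assoc)
  then have comm: "Q o\<^sub>L P = P o\<^sub>L Q" unfolding P_def by (rule op_powr_commute[OF S])
  have "(P + Q) o\<^sub>L (P - Q) = 0"
    using PP sq comm by (simp add: blinfun_compose_linear)
  moreover have "invertible_op (P + Q)"
    using posdef_op_add[OF posdef_op_powr[OF S] Q] by (simp add: P_def posdef_op_def)
  then obtain R where "R o\<^sub>L (P + Q) = id_blinfun" by (auto simp: invertible_op_def)
  ultimately have "P - Q = 0"
    by (metis blinfun_compose_assoc blinfun_compose_id(1) blinfun_compose_zero(2))
  then show ?thesis by (simp add: P_def)
qed

text \<open>The first identity is uniqueness of square roots; the second follows from it by taking
  inverses.\<close>

lemma op_powr_minus_one_half: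
  assumes A: "posdef_op A"
  shows "(A powr\<^sub>L (-1)) powr\<^sub>L (1/2) = A powr\<^sub>L (-1/2)"
    and "(A powr\<^sub>L (-1)) powr\<^sub>L (-1/2) = A powr\<^sub>L (1/2)"
proof -
  have A': "posdef_op (A powr\<^sub>L (-1))" by (rule posdef_op_powr[OF A])
  show half: "(A powr\<^sub>L (-1)) powr\<^sub>L (1/2) = A powr\<^sub>L (-1/2)"
    by (rule op_powr_half_eqI[OF A' posdef_op_powr[OF A]])
      (simp flip: op_powr_add[OF A])
  have "(A powr\<^sub>L (-1)) powr\<^sub>L (-1/2)
      = (A powr\<^sub>L (-1)) powr\<^sub>L (-1/2) o\<^sub>L (A powr\<^sub>L (-1/2) o\<^sub>L A powr\<^sub>L (1/2))"
    using op_powr_uminus(1)[OF A, of "1/2"] by simp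
  also have "\<dots> = ((A powr\<^sub>L (-1)) powr\<^sub>L (-1/2) o\<^sub>L (A powr\<^sub>L (-1)) powr\<^sub>L (1/2)) o\<^sub>L A powr\<^sub>L (1/2)"
    by (simp only: half blinfun_compose_assoc)
  also have "\<dots> = A powr\<^sub>L (1/2)"
    using op_powr_uminus(1)[OF A', of "1/2"] by simp
  finally show "(A powr\<^sub>L (-1)) powr\<^sub>L (-1/2) = A powr\<^sub>L (1/2)" .
qed

section \<open>Contractivity of the F-mean\<close>

text \<open>Multiplication by a self-adjoint operator on both sides preserves the Loewner order, and
  multiplication by \<open>A^s\<close> is undone by \<open>A^(-s)\<close>.\<close>

lemma sandwich_le_id_iff:
  assumes A: "posdef_op A"
  shows "A powr\<^sub>L s o\<^sub>L K o\<^sub>L A powr\<^sub>L s \<le>\<^sub>L id_blinfun \<longleftrightarrow> K \<le>\<^sub>L A powr\<^sub>L (- 2 * s)"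
proof -
  have cancel: "A powr\<^sub>L r o\<^sub>L (A powr\<^sub>L (- r) o\<^sub>L X o\<^sub>L A powr\<^sub>L (- r)) o\<^sub>L A powr\<^sub>L r = X" for r X
    using op_powr_uminus[OF A, of r]
    by (metis blinfun_compose_assoc blinfun_compose_id)
  have unit: "A powr\<^sub>L r o\<^sub>L id_blinfun o\<^sub>L A powr\<^sub>L r = A powr\<^sub>L (2 * r)" for r
    using op_powr_add[OF A, of r r] by simp
  show ?thesis
  proof
    assume "A powr\<^sub>L s o\<^sub>L K o\<^sub>L A powr\<^sub>L s \<le>\<^sub>L id_blinfun"
    from loewner_le_conj[OF selfadjoint_op_powr[OF A, of "- s"] this]
    show "K \<le>\<^sub>L A powr\<^sub>L (- 2 * s)"
      using cancel[of "- s" K] unit[of "- s"] by simp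
  next
    assume "K \<le>\<^sub>L A powr\<^sub>L (- 2 * s)"
    from loewner_le_conj[OF selfadjoint_op_powr[OF A, of s] this]
    show "A powr\<^sub>L s o\<^sub>L K o\<^sub>L A powr\<^sub>L s \<le>\<^sub>L id_blinfun"
      using cancel[of s id_blinfun] unit[of "- s"] by simp
  qed
qed

theorem theorem3p4:
  fixes A B :: "'a::complex_hilbert_space \<Rightarrow>\<^sub>L 'a" and t :: real
  assumes "posdef_op A" and "posdef_op B"
  shows "F_mean t A B \<le>\<^sub>L id_blinfun \<longleftrightarrow>
    (A powr\<^sub>L (1/2) o\<^sub>L B o\<^sub>L A powr\<^sub>L (1/2)) powr\<^sub>L t \<le>\<^sub>L A powr\<^sub>L (2 * t - 1)"
proof -
  note A = \<open>posdef_op A\<close>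
  define K where "K = (A powr\<^sub>L (1/2) o\<^sub>L B o\<^sub>L A powr\<^sub>L (1/2)) powr\<^sub>L t"
  define G where "G = A powr\<^sub>L (-1/2) o\<^sub>L K o\<^sub>L A powr\<^sub>L (-1/2)"
  define P Q where "P = G powr\<^sub>L (1/2)" and "Q = A powr\<^sub>L (1 - t)"
  have K: "posdef_op K"
    unfolding K_def
    by (intro posdef_op_powr posdef_op_conj selfadjoint_op_powr invertible_op_powr assms)
  then have G: "posdef_op G"
    unfolding G_def by (intro posdef_op_conj selfadjoint_op_powr invertible_op_powr A)
  have P: "selfadjoint_op P" and Q: "selfadjoint_op Q"
    unfolding P_def Q_def by (intro selfadjoint_op_powr G A)+
  have PP: "P o\<^sub>L P = G"
    using op_powr_add[OF G, of "1/2" "1/2"] op_powr_one[OF G] by (simp add: P_def)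
  have QQ: "Q o\<^sub>L Q = A powr\<^sub>L (2 - 2 * t)"
    using op_powr_add[OF A, of "1 - t" "1 - t"] by (simp add: Q_def)
  have Q_half: "Q o\<^sub>L A powr\<^sub>L (-1/2) = A powr\<^sub>L (1/2 - t)" "A powr\<^sub>L (-1/2) o\<^sub>L Q = A powr\<^sub>L (1/2 - t)"
    unfolding Q_def op_powr_add[OF A, symmetric] by simp_all
  have "geom_mean t (A powr\<^sub>L (-1)) B = G"
    by (simp only: geom_mean_def op_powr_minus_one_half[OF A] G_def K_def)
  then have "F_mean t A B = P o\<^sub>L (Q o\<^sub>L Q) o\<^sub>L P"
    by (simp only: F_mean_def P_def QQ)
  then have "F_mean t A B \<le>\<^sub>L id_blinfun \<longleftrightarrow> Q o\<^sub>L (P o\<^sub>L P) o\<^sub>L Q \<le>\<^sub>L id_blinfun"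
    using contraction_adjoint[OF P Q] contraction_adjoint[OF Q P] by auto
  also have "Q o\<^sub>L (P o\<^sub>L P) o\<^sub>L Q = (Q o\<^sub>L A powr\<^sub>L (-1/2)) o\<^sub>L K o\<^sub>L (A powr\<^sub>L (-1/2) o\<^sub>L Q)"
    by (simp only: PP G_def blinfun_compose_assoc)
  also have "\<dots> = A powr\<^sub>L (1/2 - t) o\<^sub>L K o\<^sub>L A powr\<^sub>L (1/2 - t)"
    by (simp only: Q_half)
  also have "\<dots> \<le>\<^sub>L id_blinfun \<longleftrightarrow> K \<le>\<^sub>L A powr\<^sub>L (2 * t - 1)"
    using sandwich_le_id_iff[OF A, of "1/2 - t" K] by simp
  finally show ?thesis unfolding K_def .
qed

end
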